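(* Let $n\ge 1$ and $N\ge 3$ be integers, and let $C_N^n$ be the $n$-th power of the cycle $C_N$ on $N$ vertices. Let $r\in\{0,1,\ldots,2n+1\}$ be the remainder of $N$ modulo $2n+2$. Then $$\gamma_{Zg}(C_N^n)=\begin{cases}\left\lceil\frac{N}{n+1}\right\rceil, & r\in\{0,1,\ldots,n+1\},\\[4pt] \left\lceil\frac{N}{n+1}\right\rceil-1, & r\in\{n+2,\ldots,2n+1\}.\end{cases}$$
   Context: $N(v)$ and $N[v]=N(v)\cup\{v\}$ denote the open and closed neighborhood of a vertex $v$. The $n$-th power $C_N^n$ of the cycle $C_N$ has the same vertex set as $C_N$, and two distinct vertices are adjacent in $C_N^n$ if and only if their distance in $C_N$ is at most $n$. Z-domination game: two players, Dominator and Staller, alternately select vertices $v_1,v_2,\ldots$ of an isolate-free graph $G$. The $i$-th move $v_i$ is legal if $N(v_i)\setminus\bigcup_{j=1}^{i-1}N[v_j]\neq\emptyset$. The game ends when no legal move is available. Dominator wants to minimize the total number of moves, Staller wants to maximize it. $\gamma_{Zg}(G)$ is the total number of moves played (by both players) when Dominator moves first and both players play optimally. *)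

theory Defs
  imports "Graph_Theory.Pair_Digraph" "Graph_Theory.Shortest_Path"
begin

text \<open>
  As in the library, a finite simple graph is a finite, symmetric, loopfree pair digraph
  (locale \<^locale>\<open>pair_graph\<close>): an edge \<open>uv\<close> is the pair of arcs \<open>(u,v)\<close> and \<open>(v,u)\<close>.
\<close>

definition open_nbhd :: "'a pair_pre_digraph \<Rightarrow> 'a \<Rightarrow> 'a set" where
  "open_nbhd G v = {u \<in> pverts G. (v, u) \<in> parcs G}"

definition closed_nbhd :: "'a pair_pre_digraph \<Rightarrow> 'a \<Rightarrow> 'a set" where
  "closed_nbhd G v = insert v (open_nbhd G v)"

definition isolate_free :: "'a pair_pre_digraph \<Rightarrow> bool" where
  "isolate_free G \<longleftrightarrow> (\<forall>v \<in> pverts G. open_nbhd G v \<noteq> {})"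

text \<open>
  Distance is the minimum length of a walk, i.e.\ the library's shortest path distance for
  unit weights; it is infinite if there is no walk.
\<close>

definition graph_dist :: "'a pair_pre_digraph \<Rightarrow> 'a \<Rightarrow> 'a \<Rightarrow> ereal" where
  "graph_dist G u v = wf_digraph.\<mu> (with_proj G) (\<lambda>_. 1) u v"

definition graph_power :: "'a pair_pre_digraph \<Rightarrow> nat \<Rightarrow> 'a pair_pre_digraph" where
  "graph_power G n =
    \<lparr> pverts = pverts G,
      parcs = {(u, v). u \<in> pverts G \<and> v \<in> pverts G \<and> u \<noteq> v \<and> graph_dist G u v \<le> ereal (real n)} \<rparr>"

text \<open>A simple graph only for \<open>N \<ge> 3\<close>.\<close>

definition cycle_graph :: "nat \<Rightarrow> nat pair_pre_digraph" where
  "cycle_graph N =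
    \<lparr> pverts = {0..<N},
      parcs = {(u, v). u < N \<and> v < N \<and> (v = Suc u mod N \<or> u = Suc v mod N)} \<rparr>"

subsection \<open>The Z-domination game\<close>

text \<open>A position is the list of the moves played so far, in chronological order.\<close>

definition dominated :: "'a pair_pre_digraph \<Rightarrow> 'a list \<Rightarrow> 'a set" where
  "dominated G vs = (\<Union>w \<in> set vs. closed_nbhd G w)"

definition Z_legal_moves :: "'a pair_pre_digraph \<Rightarrow> 'a list \<Rightarrow> 'a set" where
  "Z_legal_moves G vs = {v \<in> pverts G. open_nbhd G v - dominated G vs \<noteq> {}}"

text \<open>
  Number of moves still to be played from position \<open>vs\<close> under optimal play. Dominator, who moves
  first, is to move iff an even number of moves has been played. Only finite graphs are meant; the
  value \<open>0\<close> for infinite ones is arbitrary.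
\<close>

function Z_moves_left :: "'a pair_pre_digraph \<Rightarrow> 'a list \<Rightarrow> nat" where
  "Z_moves_left G vs =
    (if \<not> finite (pverts G) \<or> Z_legal_moves G vs = {} then 0
     else if even (length vs)
       then Suc (Min ((\<lambda>v. Z_moves_left G (vs @ [v])) ` Z_legal_moves G vs))
       else Suc (Max ((\<lambda>v. Z_moves_left G (vs @ [v])) ` Z_legal_moves G vs)))"
  by pat_completeness auto

lemma card_undominated_less:
  assumes "finite (pverts G)" "v \<in> Z_legal_moves G vs"
  shows "card (pverts G - dominated G (vs @ [v])) < card (pverts G - dominated G vs)"
proof (rule psubset_card_mono)
  show "pverts G - dominated G (vs @ [v]) \<subset> pverts G - dominated G vs"
    using assms(2) by (auto simp: Z_legal_moves_def dominated_def closed_nbhd_def open_nbhd_def)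
qed (use assms(1) in simp)

termination Z_moves_left
  by (relation "Wellfounded.measure (\<lambda>(G, vs). card (pverts G - dominated G vs))")
    (auto simp: card_undominated_less)

declare Z_moves_left.simps [simp del]

definition gamma_Zg :: "'a pair_pre_digraph \<Rightarrow> nat" where
  "gamma_Zg G = Z_moves_left G []"

subsection \<open>Powers of cycles are isolate-free simple graphs\<close>

lemma pair_graph_cycle_graph:
  assumes "N \<ge> 3"
  shows "pair_graph (cycle_graph N)"
proof
  have "parcs (cycle_graph N) \<subseteq> {0..<N} \<times> {0..<N}"
    by (auto simp: cycle_graph_def)
  then show "finite (parcs (cycle_graph N))"
    by (rule finite_subset) simp
  show "symmetric (with_proj (cycle_graph N))"
    by (auto simp: symmetric_def sym_def arcs_ends_conv cycle_graph_def)
  show "fst e \<noteq> snd e" if "e \<in> parcs (cycle_graph N)" for e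
    using that assms by (auto simp: cycle_graph_def mod_Suc split: if_splits)
qed (auto simp: cycle_graph_def)

lemma graph_dist_le_sym:
  assumes "pair_graph G"
  shows "graph_dist G u v \<le> graph_dist G v u"
proof -
  interpret pair_graph G by fact
  have *: "awalk_cost (\<lambda>_. 1) (rev_path p) = awalk_cost (\<lambda>_. 1) p" for p :: "('a \<times> 'a) list"
    by (induction p) auto
  show ?thesis
    unfolding graph_dist_def \<mu>_def
    by (rule INF_greatest) (metis * INF_lower awalk_rev_path mem_Collect_eq rev_path_rev_path)
qed

lemma pair_graph_graph_power:
  assumes "pair_graph G"
  shows "pair_graph (graph_power G n)"
proof -
  interpret pair_graph G by fact
  show ?thesis
  proof
    have "parcs (graph_power G n) \<subseteq> pverts G \<times> pverts G"
      by (auto simp: graph_power_def)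
    then show "finite (parcs (graph_power G n))"
      by (rule finite_subset) simp
    show "symmetric (with_proj (graph_power G n))"
      by (auto simp: symmetric_def sym_def arcs_ends_conv graph_power_def
          intro: order_trans[OF graph_dist_le_sym[OF assms]])
  qed (auto simp: graph_power_def)
qed

lemma isolate_free_cycle_power:
  assumes "n \<ge> 1" "N \<ge> 3"
  shows "isolate_free (graph_power (cycle_graph N) n)"
  unfolding isolate_free_def
proof
  fix v assume "v \<in> pverts (graph_power (cycle_graph N) n)"
  then have v: "v < N" by (simp add: graph_power_def cycle_graph_def)
  interpret pair_graph "cycle_graph N" by (rule pair_graph_cycle_graph) fact
  let ?u = "Suc v mod N"
  have arc: "(v, ?u) \<in> parcs (cycle_graph N)"
    using v by (simp add: cycle_graph_def)
  then have "awalk v [(v, ?u)] ?u"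
    using arc_implies_awalk[OF arc] by simp
  then have "graph_dist (cycle_graph N) v ?u \<le> ereal 1"
    unfolding graph_dist_def using min_cost_le_walk_cost[of v "[(v, ?u)]" ?u "\<lambda>_. 1"] by simp
  also have "\<dots> \<le> ereal (real n)" using assms by simp
  finally have "graph_dist (cycle_graph N) v ?u \<le> ereal (real n)" .
  moreover have "v \<noteq> ?u" using no_loops[OF arc] by simp
  ultimately have "?u \<in> open_nbhd (graph_power (cycle_graph N) n) v"
    using v by (auto simp: open_nbhd_def graph_power_def cycle_graph_def)
  then show "open_nbhd (graph_power (cycle_graph N) n) v \<noteq> {}" by blast
qed

end

theory Submission
  imports Defs "HOL-Number_Theory.Cong"
begin

text \<open>
  For \<open>N \<ge> 2n + 2\<close> every move dominates an arc of \<open>2n + 1\<close> consecutive vertices. Staller can always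
  shift an earlier move by one at the end of a run of dominated vertices, dominating exactly one
  new vertex, so that two consecutive moves dominate at most \<open>2n + 2\<close> new vertices; this gives the
  lower bound.

  For the upper bound, let the potential of a position be the number of undominated vertices plus
  \<open>2n\<close> times the number of maximal runs of undominated vertices. Every legal move lowers it by at
  least 1: if it creates an additional run, all \<open>2n + 1\<close> vertices of its arc are new. Dominator
  lowers it by at least \<open>2n + 1\<close> by placing his arc right after a run of dominated vertices: either
  all \<open>2n + 1\<close> vertices are new, or the number of undominated runs drops. After Dominator's first
  move the potential is at most \<open>N - 1\<close>, and once it is below \<open>2n + 1\<close> the game is over.
\<close>

subsection \<open>Distances in cycles\<close>

lemma pverts_cycle_graph [simp]: "pverts (cycle_graph N) = {..<N}"
  by (auto simp: cycle_graph_def)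

lemma pverts_graph_power [simp]: "pverts (graph_power G n) = pverts G"
  by (simp add: graph_power_def)

text \<open>Each arc shifts the vertex by +1 or -1 modulo \<open>N\<close>; \<open>d\<close> is the
  sum of these signs, so back-and-forth steps cancel.\<close>

lemma cycle_walk_offset:
  assumes "N \<ge> 3" and "pre_digraph.awalk (with_proj (cycle_graph N)) u p v"
  shows "\<exists>d. \<bar>d\<bar> \<le> int (length p) \<and> int v = (int u + d) mod int N"
proof -
  interpret pair_graph "cycle_graph N" by (rule pair_graph_cycle_graph) fact
  show ?thesis
    using assms(2)
  proof (induction p arbitrary: u)
    case Nil
    then have "u = v" "u < N" by (auto simp: awalk_Nil_iff)
    then show ?case by (intro exI[of _ 0]) simp
  next
    case (Cons e p)
    then have e: "e \<in> parcs (cycle_graph N)" "u = fst e" and w: "awalk (snd e) p v"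
      by (auto simp: awalk_Cons_iff)
    obtain d where d: "\<bar>d\<bar> \<le> int (length p)" "int v = (int (snd e) + d) mod int N"
      using Cons.IH[OF w] by blast
    have "snd e = Suc u mod N \<or> u = Suc (snd e) mod N"
      using e by (auto simp: cycle_graph_def)
    then show ?case
    proof
      assume "snd e = Suc u mod N"
      then have "int (snd e) = (int u + 1) mod int N" by (simp add: zmod_int add.commute)
      then have "int v = (int u + (d + 1)) mod int N"
        using d(2) by (simp add: mod_add_left_eq add.assoc add.commute[of d])
      then show ?thesis using d(1) by (intro exI[of _ "d + 1"]) auto
    next
      assume "u = Suc (snd e) mod N"
      then have "int u = (int (snd e) + 1) mod int N" by (simp add: zmod_int add.commute)
      then have "(int u + (d - 1)) mod int N = (int (snd e) + 1 + (d - 1)) mod int N"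
        by (simp only: mod_add_left_eq)
      then have "int v = (int u + (d - 1)) mod int N"
        using d(2) by simp
      then show ?thesis using d(1) by (intro exI[of _ "d - 1"]) auto
    qed
  qed
qed

lemma cycle_dist_add_le:
  assumes "N \<ge> 3" and "u < N"
  shows "graph_dist (cycle_graph N) u ((u + i) mod N) \<le> ereal (real i)"
proof -
  interpret pair_graph "cycle_graph N" by (rule pair_graph_cycle_graph) fact
  have "\<exists>p. awalk u p ((u + i) mod N) \<and> awalk_cost (\<lambda>_. 1) p = real i"
  proof (induction i)
    case 0
    have "awalk u [] u" using assms by (simp add: awalk_Nil_iff)
    then show ?case using assms by (intro exI[of _ "[]"]) simp
  next
    case (Suc i)
    let ?x = "(u + i) mod N" and ?y = "(u + Suc i) mod N"
    obtain p where p: "awalk u p ?x" "awalk_cost (\<lambda>_. 1) p = real i" using Suc by blast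
    have "(?x, ?y) \<in> parcs (cycle_graph N)"
      using assms by (simp add: cycle_graph_def mod_Suc_eq)
    then have "awalk ?x [(?x, ?y)] ?y" using arc_implies_awalk by fastforce
    then show ?case using p by (intro exI[of _ "p @ [(?x, ?y)]"]) auto
  qed
  then show ?thesis
    unfolding graph_dist_def by (metis min_cost_le_walk_cost)
qed

lemma cycle_dist_le_iff:
  assumes "N \<ge> 3" and "u < N" and "v < N"
  shows "graph_dist (cycle_graph N) u v \<le> ereal (real n) \<longleftrightarrow>
    (\<exists>d. \<bar>d\<bar> \<le> int n \<and> int v = (int u + d) mod int N)"
proof
  interpret pair_graph "cycle_graph N" by (rule pair_graph_cycle_graph) fact
  assume le: "graph_dist (cycle_graph N) u v \<le> ereal (real n)"
  \<comment> \<open>The distance is an infimum, so no minimal walk is at hand. Some walk is still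
    cheaper than \<open>n + 1\<close>, and as its cost is its length, that length is at most
    \<open>n\<close>.\<close>
  have "\<exists>p. awalk u p v \<and> awalk_cost (\<lambda>_. 1) p < real n + 1"
  proof (rule ccontr)
    assume "\<not> ?thesis"
    then have "ereal (real n + 1) \<le> graph_dist (cycle_graph N) u v"
      unfolding graph_dist_def \<mu>_def by (intro INF_greatest) (auto simp: not_less)
    then have "ereal (real n + 1) \<le> ereal (real n)"
      using le by (rule order_trans)
    then show False by simp
  qed
  then obtain p where p: "awalk u p v" "awalk_cost (\<lambda>_. 1) p < real n + 1" by blast
  have "awalk_cost (\<lambda>_. 1) p = real (length p)"
    by (induction p) auto
  then have "length p \<le> n" using p(2) by simp
  then show "\<exists>d. \<bar>d\<bar> \<le> int n \<and> int v = (int u + d) mod int N"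
    using cycle_walk_offset[OF assms(1) p(1)] by force
next
  assume "\<exists>d. \<bar>d\<bar> \<le> int n \<and> int v = (int u + d) mod int N"
  then obtain d where d: "\<bar>d\<bar> \<le> int n" "int v = (int u + d) mod int N" by blast
  have "graph_dist (cycle_graph N) u v \<le> ereal (real (nat \<bar>d\<bar>))"
  proof (cases "d \<ge> 0")
    case True
    then have "int v = int ((u + nat \<bar>d\<bar>) mod N)" using d(2) by (simp add: zmod_int)
    then have "v = (u + nat \<bar>d\<bar>) mod N" by (simp only: of_nat_eq_iff)
    then show ?thesis using cycle_dist_add_le[OF assms(1,2)] by metis
  next
    \<comment> \<open>Walks were only built forwards, so go from \<open>v\<close> to
      \<open>u\<close> and use the symmetry of the distance.\<close>
    case False
    then have "int ((v + nat \<bar>d\<bar>) mod N) = ((int u + d) mod int N + - d) mod int N"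
      using d(2) by (simp add: zmod_int)
    also have "\<dots> = int u" using assms(2) by (simp add: mod_diff_left_eq)
    finally have "u = (v + nat \<bar>d\<bar>) mod N" by (simp only: of_nat_eq_iff)
    then have "graph_dist (cycle_graph N) v u \<le> ereal (real (nat \<bar>d\<bar>))"
      using cycle_dist_add_le[OF assms(1,3)] by metis
    then show ?thesis
      using graph_dist_le_sym[OF pair_graph_cycle_graph[OF assms(1)]] order_trans by blast
  qed
  also have "\<dots> \<le> ereal (real n)" using d(1) by simp
  finally show "graph_dist (cycle_graph N) u v \<le> ereal (real n)" .
qed

lemma closed_nbhd_cycle_power:
  assumes "N \<ge> 3" and "v < N"
  shows "closed_nbhd (graph_power (cycle_graph N) n) v =
    {w. w < N \<and> (\<exists>d. \<bar>d\<bar> \<le> int n \<and> int w = (int v + d) mod int N)}"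
proof -
  have "\<exists>d. \<bar>d\<bar> \<le> int n \<and> int v = (int v + d) mod int N"
    using assms by (intro exI[of _ 0]) simp
  then show ?thesis
    using assms
    by (auto simp: closed_nbhd_def open_nbhd_def graph_power_def cycle_dist_le_iff)
qed

subsection \<open>Arcs of a cycle\<close>

text \<open>\<open>m\<close> counts steps, so there are \<open>m + 1\<close> vertices while
  \<open>m < N\<close>; the start \<open>s\<close> may exceed \<open>N\<close>, so
  \<open>Suc p\<close> needs no reduction.\<close>

definition cyc_arc :: "nat \<Rightarrow> nat \<Rightarrow> nat \<Rightarrow> nat set" where
  "cyc_arc N m s = (\<lambda>i. (s + i) mod N) ` {..m}"

text \<open>Indexing from the first vertex instead of the centre turns the offset \<open>d\<close>
  in [-n, n] into the index \<open>n + d\<close> in [0, 2n].\<close>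

lemma closed_nbhd_eq_cyc_arc:
  assumes "N \<ge> 3"
  shows "closed_nbhd (graph_power (cycle_graph N) n) ((s + n) mod N) = cyc_arc N (2 * n) s"
proof -
  have N: "(s + n) mod N < N" using assms by simp
  have shift: "(int ((s + n) mod N) + d) mod int N = (int s + (int n + d)) mod int N" for d
    by (simp add: zmod_int mod_add_left_eq add.assoc)
  show ?thesis
    unfolding closed_nbhd_cycle_power[OF assms N] shift
  proof (intro equalityI subsetI)
    fix w assume "w \<in> {w. w < N \<and> (\<exists>d. \<bar>d\<bar> \<le> int n \<and> int w = (int s + (int n + d)) mod int N)}"
    then obtain d where d: "\<bar>d\<bar> \<le> int n" "int w = (int s + (int n + d)) mod int N" by blast
    then have "int w = int ((s + nat (int n + d)) mod N)" by (simp add: zmod_int)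
    then have "w = (s + nat (int n + d)) mod N" by (simp only: of_nat_eq_iff)
    then show "w \<in> cyc_arc N (2 * n) s" using d(1) by (auto simp: cyc_arc_def)
  next
    fix w assume "w \<in> cyc_arc N (2 * n) s"
    then obtain i where i: "i \<le> 2 * n" "w = (s + i) mod N" by (auto simp: cyc_arc_def)
    then have "\<bar>int i - int n\<bar> \<le> int n" "int w = (int s + (int n + (int i - int n))) mod int N"
      by (auto simp: zmod_int)
    then show "w \<in> {w. w < N \<and> (\<exists>d. \<bar>d\<bar> \<le> int n \<and> int w = (int s + (int n + d)) mod int N)}"
      using i assms by (auto intro!: exI[of _ "int i - int n"])
  qed
qed

lemma finite_cyc_arc [simp]: "finite (cyc_arc N m s)"
  by (simp add: cyc_arc_def)

lemma card_cyc_arc_le: "card (cyc_arc N m s) \<le> m + 1"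
  unfolding cyc_arc_def by (rule order_trans[OF card_image_le]) auto

lemma add_mod_inj:
  fixes N :: nat
  assumes "i < N" "j < N" "(s + i) mod N = (s + j) mod N"
  shows "i = j"
  using assms by (metis cong_add_lcancel_nat cong_def mod_less)

lemma card_cyc_arc:
  assumes "m < N"
  shows "card (cyc_arc N m s) = m + 1"
proof -
  have "inj_on (\<lambda>i. (s + i) mod N) {..m}"
    using assms by (intro inj_onI) (auto dest!: add_mod_inj[rotated 2])
  then show ?thesis by (simp add: cyc_arc_def card_image)
qed

subsection \<open>The potential of a set of dominated vertices\<close>

text \<open>For a proper nonempty \<open>D \<subseteq> {..<N}\<close>, each maximal undominated run
  is counted by the dominated vertex just before it. For empty \<open>D\<close> the count is 0, so
  an untouched cycle has potential only \<open>N\<close>.\<close>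

definition run_ends :: "nat \<Rightarrow> nat set \<Rightarrow> nat set" where
  "run_ends N D = {u \<in> D. u < N \<and> Suc u mod N \<notin> D}"

definition potential :: "nat \<Rightarrow> nat \<Rightarrow> nat set \<Rightarrow> nat" where
  "potential N m D = card ({..<N} - D) + m * card (run_ends N D)"

lemma finite_run_ends [simp]: "finite (run_ends N D)"
  by (rule finite_subset[of _ "{..<N}"]) (auto simp: run_ends_def)

text \<open>Otherwise \<open>D\<close> is closed under successor on the cycle, and
  \<open>N - d + u\<close> steps from \<open>d\<close> arrive at \<open>u\<close>.\<close>

lemma run_ends_nonempty:
  assumes "d \<in> D" "d < N" "u \<notin> D" "u < N"
  shows "run_ends N D \<noteq> {}"
proof
  assume "run_ends N D = {}"
  then have step: "Suc x mod N \<in> D" if "x \<in> D" "x < N" for x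
    using that by (auto simp: run_ends_def)
  have "(d + i) mod N \<in> D" for i
  proof (induction i)
    case 0
    then show ?case using assms by simp
  next
    case (Suc i)
    then show ?case using step[of "(d + i) mod N"] assms by (simp add: mod_Suc_eq)
  qed
  from this[of "N - d + u"] show False using assms by simp
qed

text \<open>One inequality serves both players: the cardinality is 1, giving a drop of at least
  \<open>m + 1\<close>, if the arc starts right after a run end; otherwise it is 0, giving a drop of
  at least 1.\<close>

lemma potential_Un_cyc_arc:
  assumes m: "m + 1 < N" and new: "\<not> cyc_arc N m (Suc p) \<subseteq> D"
  shows "potential N m (D \<union> cyc_arc N m (Suc p)) + 1 + m * card (run_ends N D \<inter> {p mod N})
    \<le> potential N m D"
proof -
  define a where "a i = (Suc p + i) mod N" for i
  define B where "B = cyc_arc N m (Suc p)"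
  define E where "E = run_ends N D"
  define E' where "E' = run_ends N (D \<union> B)"
  define P where "P = E \<inter> {p mod N}"
  define U where "U = {..<N} - D"
  have B: "B = a ` {..m}" by (simp add: B_def cyc_arc_def a_def)
  have aN: "a i < N" for i using m by (simp add: a_def)
  have a_Suc: "Suc (a i) mod N = a (Suc i)" for i by (simp add: a_def mod_Suc_eq)
  have p_Suc: "Suc (p mod N) mod N = a 0" by (simp add: a_def mod_Suc_eq)
  have fin: "finite E" "finite E'" "finite P" "finite U" "finite B"
    by (simp_all add: E_def E'_def P_def U_def B_def)
  have PE: "P \<subseteq> E" by (simp add: P_def)
  have cP: "card (E - P) = card E - card P" "card P \<le> card E"
    using fin PE by (simp_all add: card_Diff_subset card_mono)
  \<comment> \<open>Arc vertices before \<open>a m\<close> have their successor in the arc, so only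
    the last one can become a run end.\<close>
  have E': "E' \<subseteq> insert (a m) E"
  proof
    fix u assume "u \<in> E'"
    then have u: "u \<in> D \<or> u \<in> B" "Suc u mod N \<notin> D" "Suc u mod N \<notin> B" "u < N"
      by (auto simp: E'_def run_ends_def)
    show "u \<in> insert (a m) E"
    proof (cases "u \<in> D")
      case True
      then show ?thesis using u by (simp add: E_def run_ends_def)
    next
      case False
      then obtain i where i: "i \<le> m" "u = a i" using u(1) B by blast
      have "\<not> Suc i \<le> m" using u(3) i(2) a_Suc B by auto
      then show ?thesis using i by (simp add: le_antisym not_less_eq_eq)
    qed
  qed
  have E'P: "E' \<inter> P = {}"
  proof -
    have "Suc (p mod N) mod N \<in> B" using p_Suc B by auto
    then show ?thesis by (auto simp: E'_def run_ends_def P_def)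
  qed
  have U': "{..<N} - (D \<union> B) = U - B" by (auto simp: U_def)
  obtain x where x: "x \<in> B" "x \<notin> D" using new by (auto simp: B_def)
  moreover from x have "x < N" using B aN by auto
  ultimately have "U - B \<subset> U" by (auto simp: U_def)
  then have "card (U - B) < card U" by (rule psubset_card_mono[OF fin(4)])
  then have cU: "card (U - B) + 1 \<le> card U" by simp
  have "card (U - B) + m * card E' + 1 + m * card P \<le> card U + m * card E"
  proof (cases "a m \<in> E' \<and> a m \<notin> D")
    \<comment> \<open>No run end is created, and those in \<open>P\<close> are lost; one new vertex
      supplies the extra 1.\<close>
    case False
    then have "E' \<subseteq> E - P"
      using E' E'P aN by (auto simp: E_def E'_def run_ends_def)
    then have "card E' \<le> card (E - P)" using fin by (intro card_mono) auto
    then have "card E' + card P \<le> card E" using cP by simp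
    then have "m * (card E' + card P) \<le> m * card E" by (rule mult_le_mono2)
    then show ?thesis using cU by (simp add: algebra_simps)
  next
    case True
    show ?thesis
    proof (cases "\<exists>i<m. a i \<in> D \<and> a (Suc i) \<notin> D")
      \<comment> \<open>A dominated run ends inside the arc at \<open>a i\<close>. This end is
        swallowed, making up for the new end \<open>a m\<close>; it differs from
        \<open>p mod N\<close>, so the loss of \<open>P\<close> counts separately.\<close>
      case True
      then obtain i where i: "i < m" "a i \<in> D" "a (Suc i) \<notin> D" by blast
      then have wE: "a i \<in> E" using aN a_Suc by (simp add: E_def run_ends_def)
      have wE': "a i \<notin> E'" using i(1) B a_Suc by (auto simp: E'_def run_ends_def)
      have "a i \<noteq> p mod N"
      proof
        assume "a i = p mod N"
        then have "(p + Suc i) mod N = (p + 0) mod N" by (simp add: a_def)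
        then show False using add_mod_inj[of "Suc i" N 0 p] i(1) m by simp
      qed
      then have wP: "a i \<notin> P" by (simp add: P_def)
      have "E' - {a m} \<subseteq> E - P - {a i}" using E' E'P wE' by blast
      then have "card (E' - {a m}) \<le> card (E - P - {a i})" using fin by (intro card_mono) auto
      also have "\<dots> = card E - card P - 1" using wE wP cP fin by simp
      finally have "card E' - 1 \<le> card E - card P - 1" 
        using fin by (simp add: card_Diff_singleton_if split: if_splits)
      \<comment> \<open>Ensures that the truncated subtraction of 1 above loses nothing.\<close>
      moreover have "card (E - P) > 0" using wE wP fin by (auto simp: card_gt_0_iff)
      ultimately have "card E' + card P \<le> card E" using cP by simp
      then have "m * (card E' + card P) \<le> m * card E" by (rule mult_le_mono2)
      then show ?thesis using cU by (simp add: algebra_simps)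
    next
      case False
      \<comment> \<open>Going backwards from \<open>a m\<close>, the whole arc was undominated: its
        \<open>m + 1\<close> new vertices pay \<open>m\<close> for the additional run end and leave
        1.\<close>
      have "a i \<notin> D" if "i \<le> m" for i
        using that
      proof (induction rule: inc_induct)
        case base
        then show ?case using True by simp
      next
        case (step i)
        then show ?case using False by auto
      qed
      then have "B \<subseteq> U" using B aN by (auto simp: U_def)
      then have "card (U - B) = card U - card B" "card B \<le> card U"
        using fin by (simp_all add: card_Diff_subset card_mono)
      moreover have "card B = m + 1" unfolding B_def using m by (intro card_cyc_arc) simp
      ultimately have cU': "card (U - B) + m + 1 = card U" by simp
      have "E' \<subseteq> insert (a m) (E - P)" using E' E'P by blast
      then have "card E' \<le> card (insert (a m) (E - P))" using fin by (intro card_mono) auto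
      also have "\<dots> \<le> Suc (card (E - P))" by (rule card_insert_le_m1) (use fin in auto)
      finally have "card E' + card P \<le> card E + 1" using cP by simp
      then have "m * (card E' + card P) \<le> m * (card E + 1)" by (rule mult_le_mono2)
      then show ?thesis using cU' by (simp add: algebra_simps)
    qed
  qed
  then show ?thesis
    by (simp add: potential_def U' flip: B_def E_def E'_def P_def U_def)
qed

subsection \<open>Optimal play\<close>

lemma finite_Z_legal_moves: "finite (pverts G) \<Longrightarrow> finite (Z_legal_moves G vs)"
  by (simp add: Z_legal_moves_def)

lemma Z_moves_left_over: "Z_legal_moves G vs = {} \<Longrightarrow> Z_moves_left G vs = 0"
  by (subst Z_moves_left.simps) simp

lemma Z_moves_left_Dominator_le:
  assumes "finite (pverts G)" "even (length vs)" "v \<in> Z_legal_moves G vs"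
  shows "Z_moves_left G vs \<le> Suc (Z_moves_left G (vs @ [v]))"
  using assms finite_Z_legal_moves[OF assms(1), of vs]
  by (subst Z_moves_left.simps) auto

lemma Z_moves_left_Dominator_ge:
  assumes "finite (pverts G)" "even (length vs)" "Z_legal_moves G vs \<noteq> {}"
    and "\<And>v. v \<in> Z_legal_moves G vs \<Longrightarrow> k \<le> Z_moves_left G (vs @ [v])"
  shows "Suc k \<le> Z_moves_left G vs"
  using assms finite_Z_legal_moves[OF assms(1), of vs]
  by (subst Z_moves_left.simps) auto

lemma Z_moves_left_Staller_ge:
  assumes "finite (pverts G)" "odd (length vs)" "v \<in> Z_legal_moves G vs"
  shows "Suc (Z_moves_left G (vs @ [v])) \<le> Z_moves_left G vs"
  using assms finite_Z_legal_moves[OF assms(1), of vs]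
  by (subst (2) Z_moves_left.simps) auto

lemma Z_moves_left_Staller_le:
  assumes "finite (pverts G)" "odd (length vs)"
    and "\<And>v. v \<in> Z_legal_moves G vs \<Longrightarrow> Suc (Z_moves_left G (vs @ [v])) \<le> k"
  shows "Z_moves_left G vs \<le> k"
proof (cases "Z_legal_moves G vs = {}")
  case True
  then show ?thesis by (simp add: Z_moves_left_over)
next
  case False
  let ?M = "(\<lambda>v. Z_moves_left G (vs @ [v])) ` Z_legal_moves G vs"
  have "Max ?M \<in> ?M"
    using False finite_Z_legal_moves[OF assms(1), of vs] by (intro Max_in) auto
  then have "Suc (Max ?M) \<le> k" using assms(3) by auto
  then show ?thesis using assms False by (subst Z_moves_left.simps) simp
qed

lemma dominated_snoc: "dominated G (vs @ [v]) = dominated G vs \<union> closed_nbhd G v"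
  by (auto simp: dominated_def)

lemma Z_legal_moves_new:
  "v \<in> Z_legal_moves G vs \<Longrightarrow> \<not> closed_nbhd G v \<subseteq> dominated G vs"
  by (auto simp: Z_legal_moves_def closed_nbhd_def)

text \<open>Any neighbour of an undominated vertex is a legal move, so the game only stops once
  every vertex is dominated.\<close>

lemma Z_legal_moves_nonempty:
  assumes "pair_graph G" "isolate_free G" "u \<in> pverts G" "u \<notin> dominated G vs"
  shows "Z_legal_moves G vs \<noteq> {}"
proof -
  interpret pair_graph G by fact
  obtain w where w: "w \<in> open_nbhd G u"
    using assms by (auto simp: isolate_free_def)
  then have "u \<in> open_nbhd G w"
    using assms(3) by (auto simp: open_nbhd_def arcs_symmetric)
  then show ?thesis using w assms(4) by (auto simp: Z_legal_moves_def open_nbhd_def)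
qed

subsection \<open>The game on powers of cycles\<close>

text \<open>Makes \<open>v\<close> the centre of the arc starting at \<open>Suc p\<close> with
  \<open>p = v + N - Suc n\<close>, the form used in \<open>potential_Un_cyc_arc\<close>; adding
  \<open>N\<close> keeps the subtraction from truncating.\<close>

lemma cycle_power_move:
  assumes "n < N" "v < N"
  shows "(Suc (v + N - Suc n) + n) mod N = v"
  using assms by simp

text \<open>\<open>i \<noteq> n\<close> excludes the centre, as legality asks for a new vertex in
  the open neighbourhood; \<open>2 * n < N\<close> makes distinct indices distinct vertices.\<close>

lemma cycle_power_legalI:
  assumes "N \<ge> 3" "2 * n < N" "i \<le> 2 * n" "i \<noteq> n"
    and "(s + i) mod N \<notin> dominated (graph_power (cycle_graph N) n) vs"
  shows "(s + n) mod N \<in> Z_legal_moves (graph_power (cycle_graph N) n) vs"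
proof -
  have "(s + i) mod N \<in> closed_nbhd (graph_power (cycle_graph N) n) ((s + n) mod N)"
    unfolding closed_nbhd_eq_cyc_arc[OF assms(1)] using assms(3) by (auto simp: cyc_arc_def)
  moreover have "(s + i) mod N \<noteq> (s + n) mod N"
    using add_mod_inj[of i N n s] assms by auto
  ultimately show ?thesis
    using assms by (auto simp: Z_legal_moves_def closed_nbhd_def)
qed

lemma run_ends_dominated_nonempty:
  assumes "vs \<noteq> []" "set vs \<subseteq> {..<N}"
    and "u < N" "u \<notin> dominated (graph_power (cycle_graph N) n) vs"
  shows "run_ends N (dominated (graph_power (cycle_graph N) n) vs) \<noteq> {}"
proof -
  obtain v where v: "v \<in> set vs" using assms(1) by (cases vs) auto
  then have "v \<in> dominated (graph_power (cycle_graph N) n) vs"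
    by (auto simp: dominated_def closed_nbhd_def)
  then show ?thesis using run_ends_nonempty assms v by blast
qed

context
  fixes n N :: nat
  assumes n: "n \<ge> 1" and N: "2 * n + 2 \<le> N"
begin

interpretation pair_graph "graph_power (cycle_graph N) n"
  using n N by (intro pair_graph_graph_power pair_graph_cycle_graph) auto

private abbreviation (input) "G \<equiv> graph_power (cycle_graph N) n"
private abbreviation (input) "pot vs \<equiv> potential N (2 * n) (dominated G vs)"

section \<open>Upper bound: Dominator's strategy\<close>

lemma potential_legal_move:
  assumes "v \<in> Z_legal_moves G vs"
  shows "pot (vs @ [v]) + 1 \<le> pot vs"
proof -
  have "v < N" using assms by (simp add: Z_legal_moves_def)
  then have v: "closed_nbhd G v = cyc_arc N (2 * n) (Suc (v + N - Suc n))"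
    using closed_nbhd_eq_cyc_arc[of N n "Suc (v + N - Suc n)"] cycle_power_move[of n N v] n N
    by simp
  then have "\<not> cyc_arc N (2 * n) (Suc (v + N - Suc n)) \<subseteq> dominated G vs"
    using Z_legal_moves_new[OF assms] by simp
  then show ?thesis
    using potential_Un_cyc_arc[of "2 * n" N "v + N - Suc n" "dominated G vs"] N v
    by (simp add: dominated_snoc)
qed

text \<open>Centring at \<open>Suc p + n\<close> for a run end \<open>p\<close> makes
  \<open>Suc p\<close> new and, as \<open>n \<ge> 1\<close>, distinct from the centre. Some earlier
  move must provide the run end.\<close>

lemma Dominator_good_move:
  assumes "vs \<noteq> []" "set vs \<subseteq> {..<N}" "Z_legal_moves G vs \<noteq> {}"
  shows "\<exists>v \<in> Z_legal_moves G vs. pot (vs @ [v]) + 2 * n + 1 \<le> pot vs"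
proof -
  obtain u where "u < N" "u \<notin> dominated G vs"
    using assms(3) by (auto simp: Z_legal_moves_def open_nbhd_def)
  then obtain p where p: "p \<in> run_ends N (dominated G vs)"
    using run_ends_dominated_nonempty[OF assms(1,2)] by blast
  then have pN: "p < N" and s: "(Suc p + 0) mod N \<notin> dominated G vs"
    by (auto simp: run_ends_def)
  have v: "(Suc p + n) mod N \<in> Z_legal_moves G vs"
    by (rule cycle_power_legalI[OF _ _ _ _ s]) (use n N in auto)
  have "closed_nbhd G ((Suc p + n) mod N) = cyc_arc N (2 * n) (Suc p)"
    using n N by (intro closed_nbhd_eq_cyc_arc) simp
  moreover have "\<not> cyc_arc N (2 * n) (Suc p) \<subseteq> dominated G vs"
    using s by (auto simp: cyc_arc_def)
  moreover have "run_ends N (dominated G vs) \<inter> {p mod N} = {p}" using p pN by simp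
  ultimately have "pot (vs @ [(Suc p + n) mod N]) + 2 * n + 1 \<le> pot vs"
    using potential_Un_cyc_arc[of "2 * n" N p "dominated G vs"] N
    by (simp add: dominated_snoc)
  then show ?thesis using v by blast
qed

text \<open>Staller is to move. Her move and Dominator's reply lower the potential by at least 1 +
  (2n + 1). \<open>c\<close> records a possible last move: at potential 2n the game is over, at 2n +
  1 one more move ends it.\<close>

lemma Dominator_strategy:
  assumes "odd (length vs)" "set vs \<subseteq> {..<N}"
    and "pot vs \<le> k * (2 * n + 2) + 2 * n + c" "c \<le> 1"
  shows "Z_moves_left G vs \<le> 2 * k + c"
  using assms
proof (induction k arbitrary: vs)
  case (0 vs)
  show ?case
  proof (rule Z_moves_left_Staller_le)
    fix v assume v: "v \<in> Z_legal_moves G vs"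
    have "vs \<noteq> []" using 0 by auto
    \<comment> \<open>\<open>Dominator_good_move\<close> holds whoever is to move; here it only
      shows that a legal move forces potential at least \<open>2 * n + 1\<close>.\<close>
    then have "c = 1"
      using Dominator_good_move[of vs] 0 v by fastforce
    have "Z_legal_moves G (vs @ [v]) = {}"
    proof (rule ccontr)
      assume "Z_legal_moves G (vs @ [v]) \<noteq> {}"
      moreover have "set (vs @ [v]) \<subseteq> {..<N}"
        using 0(2) v by (auto simp: Z_legal_moves_def)
      ultimately have "2 * n + 1 \<le> pot (vs @ [v])"
        using Dominator_good_move[of "vs @ [v]"] by fastforce
      then show False using potential_legal_move[OF v] 0 by simp
    qed
    then show "Suc (Z_moves_left G (vs @ [v])) \<le> 2 * 0 + c"
      using \<open>c = 1\<close> by (simp add: Z_moves_left_over)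
  qed (use 0 in auto)
next
  case (Suc k vs)
  show ?case
  proof (rule Z_moves_left_Staller_le)
    fix v assume v: "v \<in> Z_legal_moves G vs"
    let ?vs = "vs @ [v]"
    have vs': "set ?vs \<subseteq> {..<N}" using Suc.prems(2) v by (auto simp: Z_legal_moves_def)
    show "Suc (Z_moves_left G ?vs) \<le> 2 * Suc k + c"
    proof (cases "Z_legal_moves G ?vs = {}")
      case True
      then show ?thesis by (simp add: Z_moves_left_over)
    next
      case False
      then obtain w where w: "w \<in> Z_legal_moves G ?vs" "pot (?vs @ [w]) + 2 * n + 1 \<le> pot ?vs"
        using Dominator_good_move[OF _ vs'] by blast
      have "Z_moves_left G (?vs @ [w]) \<le> 2 * k + c"
      proof (rule Suc.IH)
        show "set (?vs @ [w]) \<subseteq> {..<N}" using vs' w(1) by (auto simp: Z_legal_moves_def)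
        show "pot (?vs @ [w]) \<le> k * (2 * n + 2) + 2 * n + c"
          using w(2) potential_legal_move[OF v] Suc.prems(3) by simp
      qed (use Suc.prems in auto)
      moreover have "Z_moves_left G ?vs \<le> Suc (Z_moves_left G (?vs @ [w]))"
        using Suc.prems(1) w(1) by (intro Z_moves_left_Dominator_le) auto
      ultimately show ?thesis by simp
    qed
  qed (use Suc.prems in auto)
qed

section \<open>Lower bound: Staller's strategy\<close>

lemma Staller_good_move:
  assumes "vs \<noteq> []" "set vs \<subseteq> {..<N}" "u < N" "u \<notin> dominated G vs"
  shows "\<exists>v \<in> Z_legal_moves G vs.
    card ({..<N} - dominated G vs) \<le> card ({..<N} - dominated G (vs @ [v])) + 1"
proof -
  obtain p where p: "p \<in> dominated G vs" "p < N" "Suc p mod N \<notin> dominated G vs"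
    using run_ends_dominated_nonempty[OF assms] by (auto simp: run_ends_def)
  \<comment> \<open>Staller will shift the arc of an earlier move \<open>w\<close> by one vertex,
    beyond the run end \<open>p\<close>.\<close>
  then obtain w where w: "w \<in> set vs" "p \<in> closed_nbhd G w"
    by (auto simp: dominated_def)
  define s where "s = Suc (w + N - Suc n)"
  have nbhd: "closed_nbhd G ((t + n) mod N) = cyc_arc N (2 * n) t" for t
    using n N by (intro closed_nbhd_eq_cyc_arc) simp
  have "w < N" using w(1) assms(2) by auto
  then have "w = (s + n) mod N"
    unfolding s_def using n N by (intro cycle_power_move[symmetric]) auto
  then have arc_w: "closed_nbhd G w = cyc_arc N (2 * n) s" using nbhd by simp
  then have arc_D: "cyc_arc N (2 * n) s \<subseteq> dominated G vs"
    using w(1) by (auto simp: dominated_def)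
  obtain i where i: "i \<le> 2 * n" "p = (s + i) mod N"
    using w(2) arc_w by (auto simp: cyc_arc_def)
  have succ: "Suc p mod N = (s + Suc i) mod N" using i(2) by (simp add: mod_Suc_eq)
  \<comment> \<open>If \<open>p\<close> were not the last vertex of this arc, its successor would be
    dominated as well.\<close>
  have "\<not> Suc i \<le> 2 * n"
    using p(3) arc_D succ by (auto simp: cyc_arc_def)
  then have "i = 2 * n" using i(1) by simp
  then have "Suc p mod N = (Suc s + 2 * n) mod N" using succ by simp
  then have new: "(Suc s + 2 * n) mod N \<notin> dominated G vs" using p(3) by simp
  have v: "(Suc s + n) mod N \<in> Z_legal_moves G vs"
    by (rule cycle_power_legalI[OF _ _ _ _ new]) (use n N in auto)
  have "cyc_arc N (2 * n) (Suc s) \<subseteq> insert ((Suc s + 2 * n) mod N) (dominated G vs)"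
  proof
    fix x assume "x \<in> cyc_arc N (2 * n) (Suc s)"
    then obtain j where j: "j \<le> 2 * n" "x = (Suc s + j) mod N" by (auto simp: cyc_arc_def)
    show "x \<in> insert ((Suc s + 2 * n) mod N) (dominated G vs)"
    proof (cases "j = 2 * n")
      case False
      then have "Suc j \<le> 2 * n" "x = (s + Suc j) mod N" using j by simp_all
      then have "x \<in> cyc_arc N (2 * n) s" unfolding cyc_arc_def by blast
      then show ?thesis using arc_D by blast
    qed (use j in simp)
  qed
  then have "{..<N} - dominated G vs \<subseteq>
      insert ((Suc s + 2 * n) mod N) ({..<N} - dominated G (vs @ [(Suc s + n) mod N]))"
    unfolding dominated_snoc nbhd by blast
  then have "card ({..<N} - dominated G vs) \<le>
      card (insert ((Suc s + 2 * n) mod N) ({..<N} - dominated G (vs @ [(Suc s + n) mod N])))"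
    by (intro card_mono) auto
  also have "\<dots> \<le> card ({..<N} - dominated G (vs @ [(Suc s + n) mod N])) + 1"
    by (simp add: card_insert_if)
  finally show ?thesis using v by blast
qed

lemma card_undominated_move:
  assumes "v < N"
  shows "card ({..<N} - dominated G vs) \<le> card ({..<N} - dominated G (vs @ [v])) + 2 * n + 1"
proof -
  have "closed_nbhd G v = cyc_arc N (2 * n) (Suc (v + N - Suc n))"
    using closed_nbhd_eq_cyc_arc[of N n "Suc (v + N - Suc n)"] cycle_power_move[of n N v] n N assms
    by simp
  then have B: "card (closed_nbhd G v) \<le> 2 * n + 1" "finite (closed_nbhd G v)"
    using card_cyc_arc_le[of N "2 * n"] by simp_all
  have "{..<N} - dominated G vs \<subseteq> ({..<N} - dominated G (vs @ [v])) \<union> closed_nbhd G v"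
    by (auto simp: dominated_snoc)
  then have "card ({..<N} - dominated G vs) \<le>
      card (({..<N} - dominated G (vs @ [v])) \<union> closed_nbhd G v)"
    using B(2) by (intro card_mono) auto
  also have "\<dots> \<le> card ({..<N} - dominated G (vs @ [v])) + card (closed_nbhd G v)"
    by (rule card_Un_le)
  finally show ?thesis using B(1) by simp
qed

text \<open>Dominator is to move. His move dominates at most \<open>2 * n + 1\<close> new vertices
  and Staller's reply one, so plain counting replaces the potential. With \<open>c = 1\<close> a
  leftover vertex forces one more move.\<close>

lemma Staller_strategy:
  assumes "even (length vs)" "set vs \<subseteq> {..<N}"
    and "k * (2 * n + 2) + c \<le> card ({..<N} - dominated G vs)" "c \<le> 1"
  shows "2 * k + c \<le> Z_moves_left G vs"
proof -
  have legal: "Z_legal_moves G us \<noteq> {}" if pos: "card ({..<N} - dominated G us) > 0" for us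
  proof -
    obtain u where "u < N" "u \<notin> dominated G us" using pos by (auto simp: card_gt_0_iff)
    then show ?thesis
      using isolate_free_cycle_power[of n N] n N
      by (intro Z_legal_moves_nonempty[of _ u] pair_graph_axioms) auto
  qed
  show ?thesis
    using assms
  proof (induction k arbitrary: vs)
    case (0 vs)
    show ?case
    proof (cases "c = 0")
      case False
      then have "Z_legal_moves G vs \<noteq> {}" using 0 by (intro legal) simp
      then have "Suc 0 \<le> Z_moves_left G vs"
        using 0(1) by (intro Z_moves_left_Dominator_ge) auto
      then show ?thesis using 0 by simp
    qed simp
  next
    case (Suc k vs)
    have "Suc (2 * k + c + 1) \<le> Z_moves_left G vs"
    proof (rule Z_moves_left_Dominator_ge)
      show "Z_legal_moves G vs \<noteq> {}" using Suc.prems by (intro legal) simp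
      fix v assume v: "v \<in> Z_legal_moves G vs"
      let ?vs = "vs @ [v]"
      have "v < N" using v by (simp add: Z_legal_moves_def)
      then have vs': "set ?vs \<subseteq> {..<N}" using Suc.prems(2) by auto
      \<comment> \<open>The remaining 1 keeps a vertex undominated, so Staller can reply.\<close>
      have le: "k * (2 * n + 2) + c + 1 \<le> card ({..<N} - dominated G ?vs)"
        using Suc.prems(3) card_undominated_move[OF \<open>v < N\<close>, of vs] by simp
      then have "card ({..<N} - dominated G ?vs) > 0" by simp
      then obtain u where "u < N" "u \<notin> dominated G ?vs" by (auto simp: card_gt_0_iff)
      then obtain w where w: "w \<in> Z_legal_moves G ?vs"
        "card ({..<N} - dominated G ?vs) \<le> card ({..<N} - dominated G (?vs @ [w])) + 1"
        using Staller_good_move[OF _ vs'] by blast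
      have "2 * k + c \<le> Z_moves_left G (?vs @ [w])"
      proof (rule Suc.IH)
        show "set (?vs @ [w]) \<subseteq> {..<N}" using vs' w(1) by (auto simp: Z_legal_moves_def)
        show "k * (2 * n + 2) + c \<le> card ({..<N} - dominated G (?vs @ [w]))"
          using le w(2) by simp
      qed (use Suc.prems in auto)
      moreover have "Suc (Z_moves_left G (?vs @ [w])) \<le> Z_moves_left G ?vs"
        using Suc.prems(1) w(1) by (intro Z_moves_left_Staller_ge) auto
      ultimately show "2 * k + c + 1 \<le> Z_moves_left G ?vs" by simp
    qed (use Suc.prems in auto)
    then show ?case by simp
  qed
qed

section \<open>The value of the game and its ceiling form\<close>

lemma gamma_Zg_cycle_power_large:
  "gamma_Zg G = 2 * (N div (2 * n + 2)) + (if N mod (2 * n + 2) = 0 then 0 else 1)"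
proof (rule antisym)
  define q where "q = N div (2 * n + 2)"
  define r where "r = N mod (2 * n + 2)"
  have qr: "N = q * (2 * n + 2) + r" "r < 2 * n + 2"
    by (simp_all only: q_def r_def div_mult_mod_eq) simp
  have dom_Nil: "dominated G [] = {}" by (simp add: dominated_def)
  have "q * (2 * n + 2) + (if r = 0 then 0 else 1) \<le> card ({..<N} - dominated G [])"
  proof -
    have "card ({..<N} - dominated G []) = N" by (simp add: dom_Nil)
    then show ?thesis using qr(1) by auto
  qed
  then have "2 * q + (if r = 0 then 0 else 1) \<le> Z_moves_left G []"
    by (intro Staller_strategy) auto
  then show "2 * (N div (2 * n + 2)) + (if N mod (2 * n + 2) = 0 then 0 else 1) \<le> gamma_Zg G"
    unfolding gamma_Zg_def by (simp only: q_def r_def)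
  have "Z_legal_moves G [] \<noteq> {}"
    using isolate_free_cycle_power[of n N] n N
    by (intro Z_legal_moves_nonempty[of _ 0] pair_graph_axioms) (auto simp: dom_Nil)
  then obtain v where v: "v \<in> Z_legal_moves G []" by blast
  \<comment> \<open>Any legal first move will do: \<open>run_ends\<close> is empty at the start, so
    the potential is at most \<open>N - 1\<close> afterwards.\<close>
  have "pot [] = N" by (simp add: dom_Nil potential_def run_ends_def)
  then have pot: "pot [v] + 1 \<le> N" using potential_legal_move[OF v] by simp
  have vN: "set [v] \<subseteq> {..<N}" using v by (simp add: Z_legal_moves_def)
  obtain q' where q': "q = Suc q'" using N qr by (cases q) auto
  have "Z_moves_left G [v] + 1 \<le> 2 * q + (if r = 0 then 0 else 1)"
  \<comment> \<open>For \<open>r = 0\<close>, N - 1 = q' (2n + 2) + 2n + 1, so \<open>c = 1\<close>;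
    otherwise N - 1 \<le> q (2n + 2) + 2n, so \<open>c = 0\<close>.\<close>
  proof (cases "r = 0")
    case True
    have "Z_moves_left G [v] \<le> 2 * q' + 1"
      using pot qr True q' vN by (intro Dominator_strategy) auto
    then show ?thesis using True q' by simp
  next
    case False
    have "Z_moves_left G [v] \<le> 2 * q + 0"
      using pot qr False vN by (intro Dominator_strategy) auto
    then show ?thesis using False by simp
  qed
  moreover have "gamma_Zg G \<le> Suc (Z_moves_left G [v])"
    unfolding gamma_Zg_def using Z_moves_left_Dominator_le[of G "[]" v] v by simp
  ultimately show "gamma_Zg G \<le> 2 * (N div (2 * n + 2)) + (if N mod (2 * n + 2) = 0 then 0 else 1)"
    by (simp add: q_def r_def)
qed

end

text \<open>The graph is complete, so the first move dominates everything.\<close>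

lemma gamma_Zg_cycle_power_small:
  assumes "n \<ge> 1" "N \<ge> 3" "N \<le> 2 * n + 1"
  shows "gamma_Zg (graph_power (cycle_graph N) n) = 1"
proof -
  define G where "G = graph_power (cycle_graph N) n"
  have pv: "pverts G = {..<N}" by (simp add: G_def)
  have G: "pair_graph G" "isolate_free G"
    unfolding G_def using assms
    by (simp_all add: pair_graph_graph_power pair_graph_cycle_graph isolate_free_cycle_power)
  have legal: "Z_legal_moves G [] \<noteq> {}"
    by (rule Z_legal_moves_nonempty[OF G, of 0]) (use assms pv in \<open>auto simp: dominated_def\<close>)
  have over: "Z_legal_moves G [v] = {}" if "v < N" for v
  proof -
    have "{..<N} \<subseteq> closed_nbhd G v"
    proof
      fix u assume "u \<in> {..<N}"
      then have u: "u < N" by simp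
      have "\<exists>d. \<bar>d\<bar> \<le> int n \<and> int u = (int v + d) mod int N"
      proof -
        \<comment> \<open>If the direct way is longer than \<open>n\<close>, the way round has
          length N - |u - v| \<le> n because \<open>N \<le> 2 * n + 1\<close>.\<close>
        consider "\<bar>int u - int v\<bar> \<le> int n" | "int u - int v > int n" | "int v - int u > int n"
          by linarith
        then show ?thesis
        proof cases
          case 1
          then show ?thesis using u by (intro exI[of _ "int u - int v"]) simp
        next
          case 2
          have "(int v + (int u - int v - int N)) mod int N = int u" using u by simp
          then show ?thesis
            using 2 u that assms by (intro exI[of _ "int u - int v - int N"]) auto
        next
          case 3
          have "(int v + (int u - int v + int N)) mod int N = int u" using u by simp
          then show ?thesis
            using 3 u that assms by (intro exI[of _ "int u - int v + int N"]) auto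
        qed
      qed
      then show "u \<in> closed_nbhd G v"
        unfolding G_def closed_nbhd_cycle_power[OF assms(2) that] using u by simp
    qed
    then show ?thesis by (auto simp: Z_legal_moves_def dominated_def open_nbhd_def pv)
  qed
  obtain v where v: "v \<in> Z_legal_moves G []" using legal by blast
  then have "v < N" by (simp add: Z_legal_moves_def pv)
  have "Z_moves_left G [] \<le> Suc (Z_moves_left G ([] @ [v]))"
    using v pv by (intro Z_moves_left_Dominator_le) auto
  then have "gamma_Zg G \<le> 1"
    using over[OF \<open>v < N\<close>] by (simp add: gamma_Zg_def Z_moves_left_over)
  moreover have "Suc 0 \<le> gamma_Zg G"
    unfolding gamma_Zg_def using legal pv by (intro Z_moves_left_Dominator_ge) auto
  ultimately show ?thesis by (simp add: G_def)
qed

lemma gamma_Zg_cycle_power: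
  assumes "n \<ge> 1" "N \<ge> 3"
  shows "gamma_Zg (graph_power (cycle_graph N) n) =
    2 * (N div (2 * n + 2)) + (if N mod (2 * n + 2) = 0 then 0 else 1)"
proof (cases "2 * n + 2 \<le> N")
  case True
  then show ?thesis using gamma_Zg_cycle_power_large assms by blast
next
  case False
  then show ?thesis using gamma_Zg_cycle_power_small[of n N] assms by simp
qed

theorem corollary4p4:
  fixes n N r :: nat
  assumes "n \<ge> 1" and "N \<ge> 3" and "r = N mod (2 * n + 2)"
  shows "int (gamma_Zg (graph_power (cycle_graph N) n)) =
    (if r \<in> {0..n + 1} then \<lceil>real N / real (n + 1)\<rceil> else \<lceil>real N / real (n + 1)\<rceil> - 1)"
proof -
  define q where "q = N div (2 * n + 2)"
  have "N = q * (2 * n + 2) + r" by (simp only: q_def assms(3) div_mult_mod_eq)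
  \<comment> \<open>The summand r / (n + 1) rounds up to 0, 1 or 2; the 1 subtracted in the second
    case of the theorem turns the 2 into 1.\<close>
  then have "real N / real (n + 1) = real r / real (n + 1) + of_int (2 * int q)"
    by (simp add: field_simps)
  then have "\<lceil>real N / real (n + 1)\<rceil> = \<lceil>real r / real (n + 1)\<rceil> + 2 * int q"
    by (simp only: ceiling_add_of_int)
  moreover have "\<lceil>real r / real (n + 1)\<rceil> = (if r = 0 then 0 else if r \<le> n + 1 then 1 else 2)"
  proof -
    have "r < 2 * n + 2" by (simp add: assms(3))
    then show ?thesis by (auto simp: ceiling_eq_iff field_simps)
  qed
  ultimately show ?thesis
    using gamma_Zg_cycle_power[OF assms(1,2)] assms(3) by (simp add: q_def)
qed

end
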